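(* Assume that for every $x\in\mathbb{R}^d$ the map $\Theta\ni\theta\mapsto\psi_\theta(x)\in\mathbb{R}^d$ is continuous, and let $$\mathcal{S}=\{\psi^{\bullet}\in\mathbb{R}^d:\ \psi(\psi^{\bullet})=\psi^{\bullet},\ \text{where } \psi\in\mathcal{L}_\Theta^\mu \text{ has Lipschitz constant } L_\psi<1\}\subseteq\mathbb{R}^d .$$ Then $\operatorname{supp}\nu=\overline{\mathcal{S}}$.
   Context: Let $\Theta$ be a metric space, $\mu$ a Borel probability measure on $\Theta$, and $\psi:\mathbb{R}^d\times\Theta\to\mathbb{R}^d$ a jointly measurable map; write $\psi_\theta(x)=\psi(x,\theta)$. Each $\psi_\theta:\mathbb{R}^d\to\mathbb{R}^d$ is Lipschitz with Lipschitz constant $L_\theta<\infty$. Assume: (i) $\int_\Theta\log(L_\theta)\,\mu(d\theta)<0$; (ii) $\int_\Theta|\log(L_\theta)|\,\mu(d\theta)<\infty$; (iii) for some $x_0\in\mathbb{R}^d$, $\int_\Theta\log^+(|\psi_\theta(x_0)|)\,\mu(d\theta)<\infty$. Under these assumptions there is a unique probability measure $\nu$ on $\mathbb{R}^d$ (the stationary measure) with $\int_{\mathbb{R}^d}\int_\Theta f(\psi_\theta(x))\,\mu(d\theta)\,\nu(dx)=\int_{\mathbb{R}^d}f(x)\,\nu(dx)$ for all bounded continuous $f$; it is the law of $S=\lim_{n\to\infty}\psi_{\theta_1}\circ\cdots\circ\psi_{\theta_n}(x)$ (a.s. limit, independent of $x$), where $\theta_1,\theta_2,\dots$ are i.i.d.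 with law $\mu$. $\mathcal{L}_\Theta^\mu$ is the closed semigroup generated by the maps $\psi_\theta$ with $\theta\in\operatorname{supp}\mu$, i.e. the closure (in the topology of uniform convergence on compact sets on the space of continuous maps $\mathbb{R}^d\to\mathbb{R}^d$) of $\{\psi_{\theta_1}\circ\cdots\circ\psi_{\theta_n}: n\in\mathbb{N},\ \theta_1,\dots,\theta_n\in\operatorname{supp}\mu\}$. A map with Lipschitz constant $<1$ has a unique fixed point, denoted by a superscript $\bullet$.
   Formalization: It is additionally assumed that μ(supp μ)=1. This is automatic for separable Θ; otherwise the claim can fail: if Θ is discrete of real-valued measurable cardinality, μ is diffuse and ψ_θ(x)=x/2, then supp μ and S are empty but supp ν={0}. *)

theory Defs
  imports "HOL-Probability.Probability"
begin

definition measure_support :: "'a::topological_space measure \<Rightarrow> 'a set" where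
  "measure_support M = {x. \<forall>U. open U \<and> x \<in> U \<longrightarrow> emeasure M U > 0}"

(* On a metric space that is not separable the support of a Borel probability measure need
   not have full measure (that it always has cannot be proved without excluding measurable
   cardinals). The property "AE x in M. x : measure_support M" says that it does; the next
   lemma shows that this is automatic for separable spaces. *)
lemma AE_in_measure_support:
  fixes M :: "'a::second_countable_topology measure"
  assumes "sets M = sets borel"
  shows "AE x in M. x \<in> measure_support M"
proof -
  let ?F = "{U. open U \<and> emeasure M U = 0}"
  obtain F' where F': "F' \<subseteq> ?F" "countable F'" "\<Union>F' = \<Union>?F"
    by (rule Lindelof[of ?F]) auto
  have "(\<Union>U\<in>F'. U) \<in> null_sets M"
    using F' assms by (intro null_sets_UN') (auto simp: null_sets_def)
  moreover have "{x \<in> space M. x \<notin> measure_support M} \<subseteq> \<Union>?F"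
    by (auto simp: measure_support_def)
  ultimately show ?thesis
    using F'(3) by (intro AE_I'[of "\<Union>F'"]) auto
qed

(* The sets {g. sup_K dist (f x) (g x) < e} with K compact; they form a base of the topology
   of uniform convergence on compact sets. The topspace is the set of continuous maps (take
   K empty). *)
definition compact_convergence_topology ::
    "('a::topological_space \<Rightarrow> 'b::metric_space) topology" where
  "compact_convergence_topology = topology_generated_by
     {{g. continuous_on UNIV g \<and> (\<forall>x\<in>K. dist (f x) (g x) < e)} | f K e.
        continuous_on UNIV f \<and> compact K \<and> 0 < e}"

(* The list ts = [t1, ..., tn] stands for the composition psi_t1 o ... o psi_tn. *)
definition generated_semigroup ::
    "('a::topological_space \<Rightarrow> 't::metric_space \<Rightarrow> 'a) \<Rightarrow> 't measure \<Rightarrow> ('a \<Rightarrow> 'a) set" where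
  "generated_semigroup \<psi> \<mu> =
     {foldr (\<circ>) (map (\<lambda>\<theta> x. \<psi> x \<theta>) ts) id | ts. ts \<noteq> [] \<and> set ts \<subseteq> measure_support \<mu>}"

definition closed_semigroup ::
    "('a::metric_space \<Rightarrow> 't::metric_space \<Rightarrow> 'a) \<Rightarrow> 't measure \<Rightarrow> ('a \<Rightarrow> 'a) set" where
  "closed_semigroup \<psi> \<mu> = compact_convergence_topology closure_of generated_semigroup \<psi> \<mu>"

definition contraction_fixed_points ::
    "('a::metric_space \<Rightarrow> 't::metric_space \<Rightarrow> 'a) \<Rightarrow> 't measure \<Rightarrow> 'a set" where
  "contraction_fixed_points \<psi> \<mu> =
     {p. \<exists>f\<in>closed_semigroup \<psi> \<mu>. (\<exists>c<1. c-lipschitz_on UNIV f) \<and> f p = p}"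

definition stationary_measure ::
    "('a::metric_space \<Rightarrow> 't::metric_space \<Rightarrow> 'a) \<Rightarrow> 't measure \<Rightarrow> 'a measure \<Rightarrow> bool" where
  "stationary_measure \<psi> \<mu> \<nu> \<longleftrightarrow> prob_space \<nu> \<and> sets \<nu> = sets borel \<and>
     (\<forall>f :: 'a \<Rightarrow> real. continuous_on UNIV f \<and> bounded (range f) \<longrightarrow>
        (\<integral>x. (\<integral>\<theta>. f (\<psi> x \<theta>) \<partial>\<mu>) \<partial>\<nu>) = (\<integral>x. f x \<partial>\<nu>))"

end

theory Submission
  imports Defs
begin

text \<open>The support of \<open>\<nu>\<close> is closed and invariant under \<open>\<psi> _ \<theta>\<close> for \<open>\<theta>\<close> in the support of \<open>\<mu>\<close>, hence
  under the closed semigroup; iterating a contraction of that semigroup from any point of the support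
  converges to its fixed point, which therefore lies in the support. Conversely, let \<open>y\<close> be in the
  support and let \<open>x\<close>, \<open>\<theta>\<^sub>1\<close>, \dots, \<open>\<theta>\<^sub>n\<close> be independent with laws \<open>\<nu>\<close>, \<open>\<mu>\<close>, \dots, \<open>\<mu>\<close>. By stationarity the
  composition of the $n$ maps sends \<open>x\<close> close to \<open>y\<close> with a probability that does not depend on $n$,
  \<open>x\<close> lies in a large ball with probability near 1, and since the mean of \<open>ln L\<close> is negative, the
  product of the Lipschitz constants is small with probability near 1 for large $n$. On the
  intersection of these events the composition is a strong contraction that moves a bounded point
  close to \<open>y\<close>, so its fixed point is close to \<open>y\<close>.\<close>

section \<open>Truncations and exponential moments of functions with negative mean\<close>

lemma integral_truncation_tendsto:
  fixes l :: "'t \<Rightarrow> real"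
  assumes "integrable M l"
  shows "(\<lambda>n. \<integral>t. max (- real n) (min (l t) (real n)) \<partial>M) \<longlonglongrightarrow> (\<integral>t. l t \<partial>M)"
    and "(\<lambda>n. \<integral>t. max (l t - real n) 0 \<partial>M) \<longlonglongrightarrow> 0"
proof -
  have [measurable]: "l \<in> borel_measurable M" using assms by auto
  have ev: "eventually (\<lambda>n. \<bar>l t\<bar> \<le> real n) sequentially" for t
    using filterlim_real_sequentially by (auto simp: filterlim_at_top)
  show "(\<lambda>n. \<integral>t. max (- real n) (min (l t) (real n)) \<partial>M) \<longlonglongrightarrow> (\<integral>t. l t \<partial>M)"
  proof (rule integral_dominated_convergence[where w="\<lambda>t. \<bar>l t\<bar>"])
    have "(\<lambda>n. max (- real n) (min (l t) (real n))) \<longlonglongrightarrow> l t" for t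
      by (rule tendsto_eventually, rule eventually_mono[OF ev[of t]]) auto
    then show "AE t in M. (\<lambda>n. max (- real n) (min (l t) (real n))) \<longlonglongrightarrow> l t" by simp
  qed (use assms in auto)
  have "(\<lambda>n. \<integral>t. max (l t - real n) 0 \<partial>M) \<longlonglongrightarrow> (\<integral>t. 0 \<partial>M)"
  proof (rule integral_dominated_convergence[where w="\<lambda>t. \<bar>l t\<bar>"])
    have "(\<lambda>n. max (l t - real n) 0) \<longlonglongrightarrow> 0" for t
      by (rule tendsto_eventually, rule eventually_mono[OF ev[of t]]) auto
    then show "AE t in M. (\<lambda>n. max (l t - real n) 0) \<longlonglongrightarrow> 0" by simp
  qed (use assms in auto)
  then show "(\<lambda>n. \<integral>t. max (l t - real n) 0 \<partial>M) \<longlonglongrightarrow> 0" by simp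
qed

text \<open>A function with negative mean is split into a bounded part \<open>g\<close>, still of negative mean, and an
  unbounded part \<open>h\<close> whose mean is so small that Markov's inequality bounds its partial sums.\<close>

lemma negative_mean_majorant:
  fixes l :: "'t \<Rightarrow> real"
  assumes "prob_space M" "integrable M l" "(\<integral>t. l t \<partial>M) < 0" "0 < a"
  obtains g h k B where "g \<in> borel_measurable M" "h \<in> borel_measurable M"
    "\<And>t. \<bar>g t\<bar> \<le> B" "\<And>t. 0 \<le> h t" "\<And>t. l t \<le> g t + h t - k" "0 < k"
    "(\<integral>t. g t \<partial>M) < 0" "(\<integral>\<^sup>+t. ennreal (h t) \<partial>M) \<le> ennreal (a * k)"
proof -
  interpret prob_space M by fact
  have [measurable]: "l \<in> borel_measurable M" using assms by auto
  \<comment> \<open>Half the modulus of the mean: the means of the truncations tend to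
    \<open>-2 * k\<close>, so they eventually lie below \<open>-k\<close>, and adding
    \<open>k\<close> keeps them negative.\<close>
  define k where "k = - (\<integral>t. l t \<partial>M) / 2"
  have k: "0 < k" and lk: "(\<integral>t. l t \<partial>M) < - k" using assms by (auto simp: k_def)
  have "eventually (\<lambda>n. (\<integral>t. max (- real n) (min (l t) (real n)) \<partial>M) < - k \<and>
      (\<integral>t. max (l t - real n) 0 \<partial>M) < a * k) sequentially"
    using integral_truncation_tendsto[OF assms(2)] lk k \<open>0 < a\<close>
    by (intro eventually_conj order_tendstoD(2)) auto
  then obtain n :: nat where n: "(\<integral>t. max (- real n) (min (l t) (real n)) \<partial>M) < - k"
      "(\<integral>t. max (l t - real n) 0 \<partial>M) < a * k"
    by (auto simp: eventually_sequentially)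
  \<comment> \<open>Cutting \<open>l\<close> off from below only increases it, and \<open>?h\<close>
    restores what is cut off from above; hence \<open>l\<close> is pointwise at most
    \<open>?g + ?h - k\<close>.\<close>
  let ?g = "\<lambda>t. max (- real n) (min (l t) (real n)) + k"
  let ?h = "\<lambda>t. max (l t - real n) 0"
  have i1: "integrable M (\<lambda>t. max (- real n) (min (l t) (real n)))"
    by (rule integrable_const_bound[where B = "real n"]) auto
  have i2: "integrable M ?h"
    by (rule Bochner_Integration.integrable_bound[OF assms(2)]) auto
  show ?thesis
  proof (rule that[of ?g ?h "real n + k" k])
    show "(\<integral>t. ?g t \<partial>M) < 0" using n i1 by (simp add: prob_space)
    show "(\<integral>\<^sup>+t. ennreal (?h t) \<partial>M) \<le> ennreal (a * k)"
      using n i2 by (subst nn_integral_eq_integral) (auto intro!: ennreal_leI)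
  qed (use k in auto)
qed

lemma exp_le_quadratic:
  fixes u :: real
  assumes "\<bar>u\<bar> \<le> 1"
  shows "exp u \<le> 1 + u + u\<^sup>2"
proof (cases "0 \<le> u")
  case True
  then show ?thesis using assms by (intro exp_bound) auto
next
  case False
  define w where "w = - u"
  have w: "0 < w" using False by (simp add: w_def)
  \<comment> \<open>The right-hand side is \<open>1 + w^3\<close>.\<close>
  have "1 \<le> (1 + w) * (1 - w + w\<^sup>2)"
    using w by (simp add: algebra_simps power2_eq_square)
  also have "\<dots> \<le> exp w * (1 - w + w\<^sup>2)"
    using exp_ge_add_one_self[of w] assms w by (intro mult_right_mono) (auto simp: w_def)
  finally have "exp (- w) \<le> 1 - w + w\<^sup>2"
    by (simp add: exp_minus field_simps)
  then show ?thesis by (simp add: w_def)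
qed

text \<open>For small \<open>c\<close> the linear term of \<open>exp (c * g t)\<close>, whose mean
  is negative, outweighs the quadratic error, which the bound on \<open>g\<close> controls. This is
  the input of the Chernoff bound for sums of \<open>g\<close>.\<close>

lemma exponential_moment_less_1:
  fixes g :: "'t \<Rightarrow> real"
  assumes "prob_space M" and g[measurable]: "g \<in> borel_measurable M" and B: "\<And>t. \<bar>g t\<bar> \<le> B"
    and neg: "(\<integral>t. g t \<partial>M) < 0"
  obtains c r where "0 < c" "0 \<le> r" "r < 1" "(\<integral>\<^sup>+t. ennreal (exp (c * g t)) \<partial>M) \<le> ennreal r"
proof -
  interpret prob_space M by fact
  define m where "m = - (\<integral>t. g t \<partial>M)"
  define D where "D = max 1 B"
  have D: "1 \<le> D" "\<bar>g t\<bar> \<le> D" for t using B[of t] by (auto simp: D_def)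
  have ig: "integrable M g" by (rule integrable_const_bound[where B = B]) (use B in auto)
  have mD: "m \<le> D"
  proof -
    have "\<bar>\<integral>t. g t \<partial>M\<bar> \<le> (\<integral>t. \<bar>g t\<bar> \<partial>M)" by simp
    also have "\<dots> \<le> (\<integral>t. D \<partial>M)" by (rule integral_mono) (use ig D in auto)
    finally show ?thesis by (simp add: m_def prob_space)
  qed
  have m: "0 < m" using neg by (simp add: m_def)
  \<comment> \<open>This \<open>c\<close> minimises \<open>1 - c * m + c^2 * D^2\<close>, and the
    minimum is \<open>1 - c * m / 2\<close>. As \<open>m \<le> D\<close>, it also satisfies
    \<open>c * D \<le> 1\<close>, which \<open>exp_le_quadratic\<close> requires.\<close>
  define c where "c = m / (2 * D\<^sup>2)"
  have c: "0 < c" using m D(1) by (simp add: c_def)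
  have cD: "c * D \<le> 1" using mD D(1) m by (simp add: c_def power2_eq_square field_simps)
  have cD2: "c * D\<^sup>2 = m / 2" using D(1) by (simp add: c_def)
  let ?r = "1 - c * m + c * (c * D\<^sup>2)"
  have pt: "exp (c * g t) \<le> 1 + c * g t + c * (c * D\<^sup>2)" for t
  proof -
    have a: "\<bar>c * g t\<bar> \<le> c * D" using D(2)[of t] c by (simp add: abs_mult)
    have "exp (c * g t) \<le> 1 + c * g t + (c * g t)\<^sup>2" by (rule exp_le_quadratic) (use a cD in simp)
    moreover have "(c * g t)\<^sup>2 \<le> (c * D)\<^sup>2" using a power_mono[OF a, of 2] by simp
    ultimately show ?thesis by (simp add: power2_eq_square algebra_simps)
  qed
  have "(\<integral>\<^sup>+t. ennreal (exp (c * g t)) \<partial>M) \<le> (\<integral>\<^sup>+t. ennreal (1 + c * g t + c * (c * D\<^sup>2)) \<partial>M)"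
    by (intro nn_integral_mono ennreal_leI pt)
  also have "\<dots> = ennreal (\<integral>t. 1 + c * g t + c * (c * D\<^sup>2) \<partial>M)"
    using ig pt by (intro nn_integral_eq_integral) (auto intro: order_trans[OF exp_ge_zero])
  also have "(\<integral>t. 1 + c * g t + c * (c * D\<^sup>2) \<partial>M) = ?r"
    using ig by (simp add: prob_space m_def)
  finally have le: "(\<integral>\<^sup>+t. ennreal (exp (c * g t)) \<partial>M) \<le> ennreal ?r" .
  show ?thesis
  proof (rule that[of c "max 0 ?r"])
    show "max 0 ?r < 1" unfolding cD2 using c m by simp
  qed (use c le in \<open>auto intro: order_trans[OF _ ennreal_leI]\<close>)
qed

section \<open>Stationarity beyond bounded continuous test functions\<close>

text \<open>The indicator of an open set is a pointwise limit of bounded continuous functions of the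
  distance to the complement, and open sets form an intersection-stable generator of the Borel
  sets.\<close>

lemma borel_measure_eqI_continuous:
  fixes M N :: "'a::metric_space measure"
  assumes M: "prob_space M" "sets M = sets borel" and N: "prob_space N" "sets N = sets borel"
    and eq: "\<And>f :: 'a \<Rightarrow> real. continuous_on UNIV f \<Longrightarrow> bounded (range f) \<Longrightarrow>
      (\<integral>x. f x \<partial>M) = (\<integral>x. f x \<partial>N)"
  shows "M = N"
proof (rule measure_eqI_generator_eq[where E = "{U. open U}" and \<Omega> = UNIV and A = "\<lambda>_. UNIV"])
  interpret M: prob_space M by fact
  interpret N: prob_space N by fact
  have [measurable_cong]: "sets M = sets borel" "sets N = sets borel" by fact+
  fix U :: "'a set" assume "U \<in> {U. open U}"
  then have U: "open U" by simp
  then have U': "U \<in> sets borel" by simp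
  show "emeasure M U = emeasure N U"
  proof (cases "U = UNIV")
    case True
    then show ?thesis using M.emeasure_space_1 N.emeasure_space_1 M(2) N(2)
      by (metis sets_eq_imp_space_eq space_borel)
  next
    case False
    \<comment> \<open>By convention \<open>infdist x {}\<close> is 0, so these functions would
      vanish for \<open>U = UNIV\<close>; this is why that case is separate.\<close>
    define f where "f = (\<lambda>(n::nat) x. min 1 (real n * infdist x (- U)))"
    have cont: "continuous_on UNIV (f n)" for n
      unfolding f_def by (intro continuous_intros)
    have f01: "0 \<le> f n x" "f n x \<le> 1" for n x by (auto simp: f_def infdist_nonneg)
    have lim: "(\<lambda>n. f n x) \<longlonglongrightarrow> indicator U x" for x
    proof (cases "x \<in> U")
      case True
      have "infdist x (- U) \<noteq> 0"
        using True False U in_closed_iff_infdist_zero[of "- U" x] by auto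
      then have p: "0 < infdist x (- U)" using infdist_nonneg[of x "- U"] by linarith
      have "eventually (\<lambda>n. 1 / infdist x (- U) \<le> real n) sequentially"
        using filterlim_real_sequentially by (auto simp: filterlim_at_top)
      then have "eventually (\<lambda>n. f n x = 1) sequentially"
        by eventually_elim (use p in \<open>auto simp: f_def field_simps\<close>)
      then show ?thesis using True by (auto intro: tendsto_eventually)
    next
      case False
      then show ?thesis by (simp add: f_def)
    qed
    have meas: "f n \<in> borel_measurable borel" for n
      using cont by (rule borel_measurable_continuous_onI)
    have conv: "(\<lambda>n. \<integral>x. f n x \<partial>P) \<longlonglongrightarrow> (\<integral>x. indicator U x \<partial>P)"
      if "prob_space P" and [measurable_cong]: "sets P = sets borel" for P
    proof (rule integral_dominated_convergence[where w = "\<lambda>_. 1"])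
      interpret prob_space P by fact
      show "integrable P (\<lambda>_. 1 :: real)" by simp
      show "indicator U \<in> borel_measurable P" using U' by measurable
      show "f n \<in> borel_measurable P" for n using meas by measurable
    qed (use lim f01 in auto)
    have "bounded (range (f n))" for n
      using f01 by (intro boundedI[where B = 1]) auto
    then have "(\<integral>x. f n x \<partial>M) = (\<integral>x. f n x \<partial>N)" for n using eq cont by blast
    then have "(\<integral>x. indicator U x \<partial>M) = (\<integral>x. indicator U x \<partial>N :: real)"
      using LIMSEQ_unique[OF conv[OF M]] conv[OF N] by simp
    then show ?thesis
      using U' by (simp add: M.emeasure_eq_measure N.emeasure_eq_measure)
  qed
qed (use M N in \<open>auto simp: Int_stable_def borel_def sets_eq_imp_space_eq
      prob_space.finite_measure finite_measure.emeasure_finite\<close>)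

text \<open>The law of \<open>\<psi> x \<theta>\<close> under the product of \<open>\<nu>\<close>
  and \<open>\<mu>\<close> has the same integrals of bounded continuous functions as
  \<open>\<nu>\<close>, hence equals \<open>\<nu>\<close>. This makes indicators of open sets and of
  balls available as test functions.\<close>

lemma stationary_nn_integral:
  fixes \<psi> :: "'a::{metric_space,second_countable_topology} \<Rightarrow> 't::metric_space \<Rightarrow> 'a"
  assumes \<mu>: "prob_space \<mu>" "sets \<mu> = sets borel"
    and \<psi>: "(\<lambda>(x, \<theta>). \<psi> x \<theta>) \<in> borel_measurable (borel \<Otimes>\<^sub>M borel)"
    and stat: "stationary_measure \<psi> \<mu> \<nu>"
    and f: "f \<in> borel_measurable borel"
  shows "(\<integral>\<^sup>+x. (\<integral>\<^sup>+\<theta>. f (\<psi> x \<theta>) \<partial>\<mu>) \<partial>\<nu>) = (\<integral>\<^sup>+x. f x \<partial>\<nu>)"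
proof -
  have \<nu>: "prob_space \<nu>" "sets \<nu> = sets borel" using stat by (auto simp: stationary_measure_def)
  interpret \<mu>: prob_space \<mu> by fact
  interpret \<nu>: prob_space \<nu> by fact
  interpret P: pair_prob_space \<nu> \<mu> ..
  have sets_P: "sets (\<nu> \<Otimes>\<^sub>M \<mu>) = sets (borel \<Otimes>\<^sub>M borel)"
    using \<mu> \<nu> by (intro sets_pair_measure_cong)
  have m: "(\<lambda>(x, \<theta>). \<psi> x \<theta>) \<in> \<nu> \<Otimes>\<^sub>M \<mu> \<rightarrow>\<^sub>M borel"
    using \<psi> measurable_cong_sets[OF sets_P refl] by blast
  define \<nu>' where "\<nu>' = distr (\<nu> \<Otimes>\<^sub>M \<mu>) borel (\<lambda>(x, \<theta>). \<psi> x \<theta>)"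
  have "\<nu>' = \<nu>"
  proof (rule borel_measure_eqI_continuous)
    show "prob_space \<nu>'" unfolding \<nu>'_def by (rule P.prob_space_distr[OF m])
    fix k :: "'a \<Rightarrow> real" assume k: "continuous_on UNIV k" "bounded (range k)"
    then have kb: "k \<in> borel_measurable borel" by (intro borel_measurable_continuous_onI)
    obtain C where C: "\<And>x. norm (k x) \<le> C" using k(2) by (auto simp: bounded_iff)
    have km: "(\<lambda>p. k (case p of (x, \<theta>) \<Rightarrow> \<psi> x \<theta>)) \<in> borel_measurable (\<nu> \<Otimes>\<^sub>M \<mu>)"
      using measurable_compose[OF m kb] .
    have "integrable (\<nu> \<Otimes>\<^sub>M \<mu>) (\<lambda>p. k (case p of (x, \<theta>) \<Rightarrow> \<psi> x \<theta>))"
      by (rule P.integrable_const_bound[where B = C]) (use C km in auto)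
    then have i: "integrable (\<nu> \<Otimes>\<^sub>M \<mu>) (\<lambda>(x, \<theta>). k (\<psi> x \<theta>))"
      by (simp add: case_prod_beta')
    have "(\<integral>x. k x \<partial>\<nu>') = (\<integral>p. k (case p of (x, \<theta>) \<Rightarrow> \<psi> x \<theta>) \<partial>(\<nu> \<Otimes>\<^sub>M \<mu>))"
      unfolding \<nu>'_def by (rule integral_distr[OF m kb])
    also have "\<dots> = (\<integral>x. (\<integral>\<theta>. k (\<psi> x \<theta>) \<partial>\<mu>) \<partial>\<nu>)"
      using P.integral_fst'[OF i] by (simp add: case_prod_beta')
    also have "\<dots> = (\<integral>x. k x \<partial>\<nu>)"
      using stat k by (auto simp: stationary_measure_def)
    finally show "(\<integral>x. k x \<partial>\<nu>') = (\<integral>x. k x \<partial>\<nu>)" .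
  qed (use \<nu> in \<open>auto simp: \<nu>'_def\<close>)
  have "f \<in> borel_measurable \<nu>'" using f by (simp add: \<nu>'_def)
  from nn_integral_distr[OF m this[unfolded \<nu>'_def]] \<open>\<nu>' = \<nu>\<close>
  have "(\<integral>\<^sup>+x. f x \<partial>\<nu>) = (\<integral>\<^sup>+p. f (case p of (x, \<theta>) \<Rightarrow> \<psi> x \<theta>) \<partial>(\<nu> \<Otimes>\<^sub>M \<mu>))"
    by (simp add: \<nu>'_def)
  also have "\<dots> = (\<integral>\<^sup>+x. (\<integral>\<^sup>+\<theta>. f (\<psi> x \<theta>) \<partial>\<mu>) \<partial>\<nu>)"
    using \<mu>.nn_integral_fst[OF measurable_compose[OF m f]] by simp
  finally show ?thesis by simp
qed

section \<open>The support of a stationary measure and its invariance\<close>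

lemma closed_measure_support: "closed (measure_support M)"
proof -
  have "- measure_support M = \<Union>{U. open U \<and> emeasure M U = 0}"
    by (auto simp: measure_support_def)
  then show ?thesis unfolding closed_def by auto
qed

lemma measure_support_ne:
  fixes M :: "'a::second_countable_topology measure"
  assumes "prob_space M" "sets M = sets borel"
  shows "measure_support M \<noteq> {}"
proof
  interpret prob_space M by fact
  assume "measure_support M = {}"
  then have "AE x in M. False" using AE_in_measure_support[OF assms(2)] by simp
  then show False by simp
qed

text \<open>A neighbourhood \<open>U\<close> of \<open>\<psi> x \<theta>0\<close> contains
  \<open>\<psi> z \<theta>\<close> for all \<open>z\<close> in a small ball around \<open>x\<close>
  and all \<open>\<theta>\<close> in a set of positive measure. By stationarity \<open>U\<close> has
  at least the product of the measures of these two sets.\<close>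

lemma stationary_support_invariant:
  fixes \<psi> :: "'a::{metric_space,second_countable_topology} \<Rightarrow> 't::metric_space \<Rightarrow> 'a"
  assumes \<mu>: "prob_space \<mu>" "sets \<mu> = sets borel"
    and \<psi>: "(\<lambda>(x, \<theta>). \<psi> x \<theta>) \<in> borel_measurable (borel \<Otimes>\<^sub>M borel)"
    and stat: "stationary_measure \<psi> \<mu> \<nu>"
    and cont: "\<And>x. continuous_on UNIV (\<lambda>\<theta>. \<psi> x \<theta>)"
    and \<Lambda>[measurable]: "\<Lambda> \<in> borel_measurable \<mu>"
    and lip: "\<And>\<theta>. (\<Lambda> \<theta>)-lipschitz_on UNIV (\<lambda>x. \<psi> x \<theta>)"
    and \<theta>0: "\<theta>0 \<in> measure_support \<mu>" and x: "x \<in> measure_support \<nu>"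
  shows "\<psi> x \<theta>0 \<in> measure_support \<nu>"
proof -
  have \<nu>: "prob_space \<nu>" "sets \<nu> = sets borel" using stat by (auto simp: stationary_measure_def)
  have [measurable_cong]: "sets \<mu> = sets borel" "sets \<nu> = sets borel" by fact+
  have sp: "space \<mu> = UNIV" using \<mu>(2) sets_eq_imp_space_eq by fastforce
  have [measurable]: "(\<lambda>\<theta>. \<psi> z \<theta>) \<in> borel_measurable \<mu>" for z
    using borel_measurable_continuous_onI[OF cont] by measurable
  show ?thesis unfolding measure_support_def
  proof (intro CollectI allI impI, elim conjE)
    fix U assume U: "open U" "\<psi> x \<theta>0 \<in> U"
    then obtain e where e: "0 < e" "ball (\<psi> x \<theta>0) e \<subseteq> U" by (auto simp: open_contains_ball)
    define V where "V = {\<theta>. dist (\<psi> x \<theta>) (\<psi> x \<theta>0) < e / 2}"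
    have oV: "open V" unfolding V_def
      using cont[of x] by (intro open_Collect_less continuous_intros) auto
    have "\<theta>0 \<in> V" using e by (simp add: V_def)
    then have Vpos: "emeasure \<mu> V > 0" using \<theta>0 oV by (auto simp: measure_support_def)
    \<comment> \<open>The Lipschitz constants may be unbounded on \<open>V\<close>, so one radius
      need not serve all of \<open>V\<close>. Since \<open>V\<close> is the union of the sets
      \<open>W n\<close>, one of them has positive measure, and there the constants are at most
      \<open>n\<close>.\<close>
    define W where "W = (\<lambda>n::nat. {\<theta> \<in> space \<mu>. dist (\<psi> x \<theta>) (\<psi> x \<theta>0) < e / 2 \<and> \<Lambda> \<theta> \<le> real n})"
    have Wm[measurable]: "W n \<in> sets \<mu>" for n unfolding W_def by measurable
    have V_eq: "V = (\<Union>n. W n)"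
      using real_arch_simple by (auto simp: V_def W_def sp)
    have "\<not> (\<forall>n. emeasure \<mu> (W n) = 0)"
    proof
      assume "\<forall>n. emeasure \<mu> (W n) = 0"
      then have "emeasure \<mu> (\<Union>n. W n) = 0" by (intro emeasure_UN_eq_0) auto
      with Vpos V_eq show False by simp
    qed
    then obtain n where n: "emeasure \<mu> (W n) \<noteq> 0" by blast
    \<comment> \<open>Adding 1 avoids a division by 0 when \<open>n = 0\<close>.\<close>
    define r where "r = e / 2 / (real n + 1)"
    have r: "0 < r" using e by (simp add: r_def)
    have in_U: "\<psi> z \<theta> \<in> U" if z: "z \<in> ball x r" and \<theta>: "\<theta> \<in> W n" for z \<theta>
    proof -
      have "dist (\<psi> x \<theta>) (\<psi> z \<theta>) \<le> \<Lambda> \<theta> * dist x z"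
        using lipschitz_onD[OF lip] by simp
      also have "\<dots> \<le> (real n + 1) * r"
        using z \<theta> r by (intro mult_mono) (auto simp: W_def)
      also have "\<dots> = e / 2"
        unfolding r_def times_divide_eq_right[of _ "e / 2"]
        by (rule nonzero_mult_div_cancel_left) linarith
      finally have "dist (\<psi> x \<theta>) (\<psi> z \<theta>) \<le> e / 2" .
      moreover have "dist (\<psi> x \<theta>) (\<psi> x \<theta>0) < e / 2" using \<theta> by (simp add: W_def)
      ultimately have "dist (\<psi> x \<theta>0) (\<psi> z \<theta>) < e"
        using dist_triangle2[of "\<psi> x \<theta>0" "\<psi> z \<theta>" "\<psi> x \<theta>"] by (simp add: dist_commute)
      then show ?thesis using e by auto
    qed
    have "0 < emeasure \<nu> (ball x r)" using x r by (auto simp: measure_support_def)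
    then have "0 < emeasure \<mu> (W n) * emeasure \<nu> (ball x r)"
      using n by (simp add: ennreal_zero_less_mult_iff zero_less_iff_neq_zero)
    also have "\<dots> = (\<integral>\<^sup>+z. emeasure \<mu> (W n) * indicator (ball x r) z \<partial>\<nu>)"
      by (subst nn_integral_cmult_indicator) auto
    also have "\<dots> \<le> (\<integral>\<^sup>+z. (\<integral>\<^sup>+\<theta>. indicator U (\<psi> z \<theta>) \<partial>\<mu>) \<partial>\<nu>)"
    proof (rule nn_integral_mono)
      fix z
      show "emeasure \<mu> (W n) * indicator (ball x r) z \<le> (\<integral>\<^sup>+\<theta>. indicator U (\<psi> z \<theta>) \<partial>\<mu>)"
      proof (cases "z \<in> ball x r")
        case True
        have "emeasure \<mu> (W n) = (\<integral>\<^sup>+\<theta>. indicator (W n) \<theta> \<partial>\<mu>)" by simp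
        also have "\<dots> \<le> (\<integral>\<^sup>+\<theta>. indicator U (\<psi> z \<theta>) \<partial>\<mu>)"
          by (intro nn_integral_mono) (use in_U[OF True] in \<open>auto simp: indicator_def\<close>)
        finally show ?thesis using True by simp
      qed simp
    qed
    also have "\<dots> = (\<integral>\<^sup>+z. indicator U z \<partial>\<nu>)"
      using U by (intro stationary_nn_integral[OF \<mu> \<psi> stat]) auto
    also have "\<dots> = emeasure \<nu> U" using U \<nu> by (intro nn_integral_indicator) auto
    finally show "emeasure \<nu> U > 0" .
  qed
qed

section \<open>Compositions, their Lipschitz constants and fixed points of limits\<close>

primrec composition :: "('a \<Rightarrow> 't \<Rightarrow> 'a) \<Rightarrow> 't list \<Rightarrow> 'a \<Rightarrow> 'a" where
  "composition \<psi> [] x = x"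
| "composition \<psi> (\<theta> # ts) x = \<psi> (composition \<psi> ts x) \<theta>"

lemma composition_append:
  "composition \<psi> (ts @ us) x = composition \<psi> ts (composition \<psi> us x)"
  by (induction ts) auto

lemma generated_semigroup_eq:
  "generated_semigroup \<psi> \<mu> = {composition \<psi> ts | ts. ts \<noteq> [] \<and> set ts \<subseteq> measure_support \<mu>}"
proof -
  have "foldr (\<circ>) (map (\<lambda>\<theta> x. \<psi> x \<theta>) ts) id x = composition \<psi> ts x" for ts x
    by (induction ts arbitrary: x) simp_all
  then have "foldr (\<circ>) (map (\<lambda>\<theta> x. \<psi> x \<theta>) ts) id = composition \<psi> ts" for ts
    by (rule ext)
  then show ?thesis by (simp only: generated_semigroup_def)
qed

text \<open>Lipschitz constants multiply; in exponential form their product becomes a sum along the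
  list, which can be compared with the accumulated values of \<open>g\<close> and \<open>h\<close>
  below.\<close>

lemma lipschitz_composition:
  fixes \<psi> :: "'a::metric_space \<Rightarrow> 't \<Rightarrow> 'a"
  assumes "\<And>\<theta>. (exp (l \<theta>))-lipschitz_on UNIV (\<lambda>x. \<psi> x \<theta>)"
  shows "(exp (\<Sum>\<theta>\<leftarrow>ts. l \<theta>))-lipschitz_on UNIV (composition \<psi> ts)"
proof (induction ts)
  case Nil
  then show ?case by (auto intro: lipschitz_onI)
next
  case (Cons t ts)
  have "(exp (l t) * exp (\<Sum>\<theta>\<leftarrow>ts. l \<theta>))-lipschitz_on UNIV ((\<lambda>x. \<psi> x t) \<circ> composition \<psi> ts)"
    using Cons lipschitz_on_subset[OF assms[of t] subset_UNIV] by (rule lipschitz_on_compose)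
  moreover have "composition \<psi> (t # ts) = (\<lambda>x. \<psi> x t) \<circ> composition \<psi> ts"
    by (rule ext) (simp only: composition.simps o_apply)
  moreover have "exp (\<Sum>\<theta>\<leftarrow>t # ts. l \<theta>) = exp (l t) * exp (\<Sum>\<theta>\<leftarrow>ts. l \<theta>)"
    by (simp add: exp_add)
  ultimately show ?case by (simp only:)
qed

lemma contraction_fixed_points_subset:
  fixes \<psi> :: "'a::{metric_space,second_countable_topology} \<Rightarrow> 't::metric_space \<Rightarrow> 'a"
  assumes inv: "\<And>x \<theta>. x \<in> S \<Longrightarrow> \<theta> \<in> measure_support \<mu> \<Longrightarrow> \<psi> x \<theta> \<in> S"
    and S: "closed S" "S \<noteq> {}"
  shows "contraction_fixed_points \<psi> \<mu> \<subseteq> S"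
proof
  fix p assume "p \<in> contraction_fixed_points \<psi> \<mu>"
  then obtain f c where f: "f \<in> closed_semigroup \<psi> \<mu>" and c: "c < 1" "c-lipschitz_on UNIV f"
    and p: "f p = p" by (auto simp: contraction_fixed_points_def)
  have comp: "composition \<psi> ts x \<in> S" if "set ts \<subseteq> measure_support \<mu>" "x \<in> S" for ts x
    using that by (induction ts) (simp_all add: inv)
  have fc: "continuous_on UNIV f" using c(2) by (rule lipschitz_on_continuous_on)
  have fS: "f x \<in> S" if x: "x \<in> S" for x
  proof -
    have "\<exists>y\<in>S. dist y (f x) < e" if e: "0 < e" for e
    proof -
      \<comment> \<open>A single point is compact, so closeness at \<open>x\<close> alone is an open
        condition, and some composition of the generators satisfies it.\<close>
      let ?T = "{g. continuous_on UNIV g \<and> (\<forall>z\<in>{x}. dist (f z) (g z) < e)}"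
      have oT: "openin compact_convergence_topology ?T"
        unfolding compact_convergence_topology_def
        by (rule topology_generated_by_Basis, rule CollectI, rule exI[of _ f], rule exI[of _ "{x}"],
            rule exI[of _ e]) (intro conjI refl fc e compact_insert compact_empty)
      have fT: "f \<in> ?T" using fc e by simp
      have "\<forall>T. f \<in> T \<and> openin compact_convergence_topology T \<longrightarrow>
          (\<exists>g. g \<in> generated_semigroup \<psi> \<mu> \<and> g \<in> T)"
        using f unfolding closed_semigroup_def in_closure_of by (rule conjunct2)
      from this[THEN spec, THEN mp, OF conjI, OF fT oT]
      obtain g where g: "g \<in> generated_semigroup \<psi> \<mu>" "dist (f x) (g x) < e"
        by auto
      from g(1) obtain ts where ts: "g = composition \<psi> ts" "set ts \<subseteq> measure_support \<mu>"
        unfolding generated_semigroup_eq by auto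
      have "dist (composition \<psi> ts x) (f x) < e"
        using g(2) ts(1) by (simp add: dist_commute)
      then show ?thesis using comp[OF ts(2) x] by (rule bexI)
    qed
    then have "\<forall>e>0. \<exists>y\<in>S. dist y (f x) < e" by blast
    then show ?thesis by (rule closed_approachable[OF S(1), THEN iffD1])
  qed
  obtain x where x: "x \<in> S" using S by auto
  have c0: "0 \<le> c" using c(2) by (rule lipschitz_on_nonneg)
  have it: "(f ^^ n) x \<in> S" for n by (induction n) (simp_all add: x fS)
  have le: "dist ((f ^^ n) x) p \<le> c ^ n * dist x p" for n
  proof (induction n)
    case (Suc n)
    have "dist ((f ^^ Suc n) x) p \<le> c * dist ((f ^^ n) x) p"
      using lipschitz_onD[OF c(2), of "(f ^^ n) x" p] p by simp
    also have "\<dots> \<le> c * (c ^ n * dist x p)" using Suc c0 by (rule mult_left_mono)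
    finally show ?case by simp
  qed simp
  have "(\<lambda>n. c ^ n * dist x p) \<longlonglongrightarrow> 0"
    using c c0 by (intro tendsto_mult_left_zero LIMSEQ_realpow_zero) auto
  then have "(\<lambda>n. dist ((f ^^ n) x) p) \<longlonglongrightarrow> 0"
    by (rule Lim_null_comparison[rotated]) (use le in simp)
  then have "(\<lambda>n. (f ^^ n) x) \<longlonglongrightarrow> p" by (rule tendsto_dist_iff[THEN iffD2])
  then show "p \<in> S" using S(1) it by (metis closed_sequentially)
qed

section \<open>Random iteration with accumulated weights\<close>

text \<open>The state $(x, u, v)$ records the current point of the random iteration and the accumulated
  values of \<open>g\<close> and \<open>h\<close> along it; \<open>transfer\<close> is the one-step expectation operator. Its iterates
  replace integrals over the product measures \<open>\<mu>\<^sup>n\<close>.\<close>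

locale weighted_iteration = prob_space \<mu> for \<mu> :: "'t::metric_space measure" +
  fixes \<psi> :: "'a::{metric_space,second_countable_topology} \<Rightarrow> 't \<Rightarrow> 'a" and g h :: "'t \<Rightarrow> real"
  assumes sets_\<mu>: "sets \<mu> = sets borel"
    and \<psi>_measurable: "(\<lambda>(x, \<theta>). \<psi> x \<theta>) \<in> borel_measurable (borel \<Otimes>\<^sub>M borel)"
    and g_measurable: "g \<in> borel_measurable \<mu>"
    and h_measurable: "h \<in> borel_measurable \<mu>"
begin

definition transfer :: "('a \<times> real \<times> real \<Rightarrow> ennreal) \<Rightarrow> 'a \<times> real \<times> real \<Rightarrow> ennreal" where
  "transfer F = (\<lambda>(x, u, v). \<integral>\<^sup>+\<theta>. F (\<psi> x \<theta>, u + g \<theta>, v + h \<theta>) \<partial>\<mu>)"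

lemma transfer_apply: "transfer F (x, u, v) = (\<integral>\<^sup>+\<theta>. F (\<psi> x \<theta>, u + g \<theta>, v + h \<theta>) \<partial>\<mu>)"
  by (simp add: transfer_def)

abbreviation state_algebra :: "('a \<times> real \<times> real) measure" where
  "state_algebra \<equiv> borel \<Otimes>\<^sub>M borel \<Otimes>\<^sub>M borel"

lemma step_measurable:
  "(\<lambda>(s, \<theta>). (\<psi> (fst s) \<theta>, fst (snd s) + g \<theta>, snd (snd s) + h \<theta>)) \<in> state_algebra \<Otimes>\<^sub>M \<mu> \<rightarrow>\<^sub>M state_algebra"
proof -
  have "(\<lambda>p. (fst (fst p), snd p)) \<in> state_algebra \<Otimes>\<^sub>M \<mu> \<rightarrow>\<^sub>M borel \<Otimes>\<^sub>M \<mu>"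
    by measurable
  then have "(\<lambda>p. (fst (fst p), snd p)) \<in> state_algebra \<Otimes>\<^sub>M \<mu> \<rightarrow>\<^sub>M borel \<Otimes>\<^sub>M borel"
    using measurable_cong_sets[OF refl sets_pair_measure_cong[OF refl sets_\<mu>]] by blast
  from measurable_compose[OF this \<psi>_measurable]
  have [measurable]: "(\<lambda>p. \<psi> (fst (fst p)) (snd p)) \<in> borel_measurable (state_algebra \<Otimes>\<^sub>M \<mu>)"
    by simp
  note [measurable] = g_measurable h_measurable
  show ?thesis unfolding case_prod_beta' by measurable
qed

lemma section_measurable:
  assumes "F \<in> borel_measurable state_algebra"
  shows "(\<lambda>\<theta>. F (\<psi> x \<theta>, u + g \<theta>, v + h \<theta>)) \<in> borel_measurable \<mu>"
proof -
  have "(\<lambda>\<theta>. ((x, u, v), \<theta>)) \<in> \<mu> \<rightarrow>\<^sub>M state_algebra \<Otimes>\<^sub>M \<mu>" by measurable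
  from measurable_compose[OF measurable_compose[OF this step_measurable] assms]
  show ?thesis by simp
qed

lemma transfer_measurable:
  assumes "F \<in> borel_measurable state_algebra"
  shows "transfer F \<in> borel_measurable state_algebra"
proof -
  have "(\<lambda>(s, \<theta>). F (\<psi> (fst s) \<theta>, fst (snd s) + g \<theta>, snd (snd s) + h \<theta>))
      \<in> borel_measurable (state_algebra \<Otimes>\<^sub>M \<mu>)"
    using measurable_compose[OF step_measurable assms] by (simp add: case_prod_beta')
  from borel_measurable_nn_integral[OF this] show ?thesis
    by (simp add: transfer_def case_prod_beta')
qed

lemma transfer_funpow_measurable:
  "F \<in> borel_measurable state_algebra \<Longrightarrow> (transfer ^^ n) F \<in> borel_measurable state_algebra"
  by (induction n) (auto intro: transfer_measurable)

lemma transfer_mono: "F \<le> G \<Longrightarrow> transfer F \<le> transfer G"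
  by (auto simp: transfer_def le_fun_def intro!: nn_integral_mono)

lemma transfer_funpow_mono: "F \<le> G \<Longrightarrow> (transfer ^^ n) F \<le> (transfer ^^ n) G"
  by (induction n) (auto intro: transfer_mono)

lemma transfer_funpow_add:
  assumes "F \<in> borel_measurable state_algebra" "G \<in> borel_measurable state_algebra"
  shows "(transfer ^^ n) (\<lambda>s. F s + G s) = (\<lambda>s. (transfer ^^ n) F s + (transfer ^^ n) G s)"
proof (induction n)
  case (Suc n)
  show ?case
    by (rule ext) (clarsimp simp: Suc transfer_apply nn_integral_add
        section_measurable[OF transfer_funpow_measurable] assms)
qed simp

lemma transfer_funpow_cmult:
  assumes "F \<in> borel_measurable state_algebra"
  shows "(transfer ^^ n) (\<lambda>s. a * F s) = (\<lambda>s. a * (transfer ^^ n) F s)"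
proof (induction n)
  case (Suc n)
  show ?case
    by (rule ext) (clarsimp simp: Suc transfer_apply nn_integral_cmult
        section_measurable[OF transfer_funpow_measurable] assms)
qed simp

lemma transfer_funpow_const: "(transfer ^^ n) (\<lambda>_. a) = (\<lambda>_. a)"
  by (induction n) (auto simp: transfer_def emeasure_space_1)

text \<open>Each step multiplies \<open>exp (c * u)\<close> by \<open>exp (c * g \<theta>)\<close>,
  whose mean is at most \<open>r\<close>. This is the exponential moment of a sum of independent
  values of \<open>g\<close>.\<close>

lemma transfer_funpow_exp:
  assumes "(\<integral>\<^sup>+\<theta>. ennreal (exp (c * g \<theta>)) \<partial>\<mu>) \<le> ennreal r" "0 \<le> r"
  shows "(transfer ^^ n) (\<lambda>(x, u, v). ennreal (exp (c * u))) (x, u, v) \<le> ennreal (exp (c * u) * r ^ n)"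
proof (induction n arbitrary: x u v)
  case (Suc n)
  note [measurable] = g_measurable
  have "(transfer ^^ Suc n) (\<lambda>(x, u, v). ennreal (exp (c * u))) (x, u, v)
      \<le> (\<integral>\<^sup>+\<theta>. ennreal (exp (c * (u + g \<theta>)) * r ^ n) \<partial>\<mu>)"
    by (auto simp: transfer_apply intro!: nn_integral_mono Suc)
  also have "\<dots> = (\<integral>\<^sup>+\<theta>. ennreal (exp (c * u) * r ^ n) * ennreal (exp (c * g \<theta>)) \<partial>\<mu>)"
    using assms(2) by (intro nn_integral_cong)
      (simp add: ennreal_mult'[symmetric] distrib_left exp_add ac_simps)
  also have "\<dots> = ennreal (exp (c * u) * r ^ n) * (\<integral>\<^sup>+\<theta>. ennreal (exp (c * g \<theta>)) \<partial>\<mu>)"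
    by (intro nn_integral_cmult) measurable
  also have "\<dots> \<le> ennreal (exp (c * u) * r ^ n) * ennreal r"
    by (intro mult_left_mono assms) auto
  also have "\<dots> = ennreal (exp (c * u) * r ^ Suc n)"
    using assms(2) by (simp add: ennreal_mult'[symmetric] ac_simps)
  finally show ?case .
qed simp

text \<open>Each step adds \<open>h \<theta>\<close>, of mean at most \<open>b\<close>. As
  \<open>h\<close> is nonnegative, \<open>v\<close> stays nonnegative, where \<open>ennreal\<close>
  is additive. Markov's inequality later uses this first moment.\<close>

lemma transfer_funpow_snd:
  assumes "(\<integral>\<^sup>+\<theta>. ennreal (h \<theta>) \<partial>\<mu>) \<le> ennreal b" "\<And>\<theta>. 0 \<le> h \<theta>" "0 \<le> b" "0 \<le> v"
  shows "(transfer ^^ n) (\<lambda>(x, u, v). ennreal v) (x, u, v) \<le> ennreal (v + real n * b)"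
  using assms(4)
proof (induction n arbitrary: x u v)
  case (Suc n)
  note [measurable] = h_measurable
  have "(transfer ^^ Suc n) (\<lambda>(x, u, v). ennreal v) (x, u, v)
      \<le> (\<integral>\<^sup>+\<theta>. ennreal (v + h \<theta> + real n * b) \<partial>\<mu>)"
    using Suc.prems assms(2) by (auto simp: transfer_apply intro!: nn_integral_mono Suc.IH)
  also have "\<dots> = (\<integral>\<^sup>+\<theta>. ennreal (v + real n * b) + ennreal (h \<theta>) \<partial>\<mu>)"
    using Suc.prems assms by (intro nn_integral_cong) (simp add: ennreal_plus[symmetric] ac_simps del: ennreal_plus)
  also have "\<dots> = ennreal (v + real n * b) + (\<integral>\<^sup>+\<theta>. ennreal (h \<theta>) \<partial>\<mu>)"
    by (subst nn_integral_add) (auto simp: emeasure_space_1)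
  also have "\<dots> \<le> ennreal (v + real n * b) + ennreal b"
    by (intro add_left_mono assms)
  also have "\<dots> = ennreal (v + real (Suc n) * b)"
    using Suc.prems assms by (simp add: ennreal_plus[symmetric] algebra_simps del: ennreal_plus)
  finally show ?case .
qed simp

text \<open>On functions of the point alone, \<open>transfer\<close> is the Markov operator of the
  iteration, which preserves integrals over \<open>\<nu>\<close>. Because the value is the same for
  every \<open>n\<close>, the number of steps can be taken large afterwards.\<close>

lemma stationary_transfer_funpow:
  assumes stat: "stationary_measure \<psi> \<mu> \<nu>" and "f \<in> borel_measurable borel"
  shows "(\<integral>\<^sup>+x. (transfer ^^ n) (\<lambda>(x, u, v). f x) (x, u, v) \<partial>\<nu>) = (\<integral>\<^sup>+x. f x \<partial>\<nu>)"
  using assms(2)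
proof (induction n arbitrary: f)
  case (Suc n)
  let ?P = "\<lambda>x. \<integral>\<^sup>+\<theta>. f (\<psi> x \<theta>) \<partial>\<mu>"
  have "(\<lambda>p. f (case p of (x, \<theta>) \<Rightarrow> \<psi> x \<theta>)) \<in> borel_measurable (borel \<Otimes>\<^sub>M borel)"
    using measurable_compose[OF \<psi>_measurable Suc.prems] .
  then have "(\<lambda>(x, \<theta>). f (\<psi> x \<theta>)) \<in> borel_measurable (borel \<Otimes>\<^sub>M \<mu>)"
    using measurable_cong_sets[OF sets_pair_measure_cong[OF refl sets_\<mu>] refl]
    by (auto simp: case_prod_beta')
  then have m: "?P \<in> borel_measurable borel" by (rule borel_measurable_nn_integral)
  have "transfer (\<lambda>(x, u, v). f x) = (\<lambda>(x, u, v). ?P x)"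
    by (auto simp: transfer_apply fun_eq_iff)
  then have "(transfer ^^ Suc n) (\<lambda>(x, u, v). f x) = (transfer ^^ n) (\<lambda>(x, u, v). ?P x)"
    by (simp only: funpow.simps o_apply funpow_swap1)
  then show ?case
    using Suc.IH[OF m] stationary_nn_integral[OF prob_space_axioms sets_\<mu> \<psi>_measurable stat Suc.prems]
    by (simp only:)
qed simp

text \<open>An iterated integral that is not 0 has a parameter in the full-measure set
  \<open>A\<close> at each stage for which the remaining integral is not 0. This turns a probability
  estimate into one concrete composition.\<close>

lemma transfer_funpow_witness:
  assumes "AE \<theta> in \<mu>. \<theta> \<in> A" "(transfer ^^ n) F (x, u, v) \<noteq> 0"
  obtains ts where "length ts = n" "set ts \<subseteq> A"
    "F (composition \<psi> ts x, u + (\<Sum>\<theta>\<leftarrow>ts. g \<theta>), v + (\<Sum>\<theta>\<leftarrow>ts. h \<theta>)) \<noteq> 0"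
proof -
  have "\<exists>ts. length ts = n \<and> set ts \<subseteq> A \<and>
      F (composition \<psi> ts x, u + (\<Sum>\<theta>\<leftarrow>ts. g \<theta>), v + (\<Sum>\<theta>\<leftarrow>ts. h \<theta>)) \<noteq> 0"
    using assms(2)
  proof (induction n arbitrary: x u v)
    case (Suc n)
    have "\<exists>\<theta>\<in>A. (transfer ^^ n) F (\<psi> x \<theta>, u + g \<theta>, v + h \<theta>) \<noteq> 0"
    proof (rule ccontr)
      assume "\<not> ?thesis"
      with assms(1) have "AE \<theta> in \<mu>. (transfer ^^ n) F (\<psi> x \<theta>, u + g \<theta>, v + h \<theta>) = 0"
        by auto
      then have "(\<integral>\<^sup>+\<theta>. (transfer ^^ n) F (\<psi> x \<theta>, u + g \<theta>, v + h \<theta>) \<partial>\<mu>) = (\<integral>\<^sup>+\<theta>. 0 \<partial>\<mu>)"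
        by (rule nn_integral_cong_AE)
      then show False using Suc.prems by (simp add: transfer_apply)
    qed
    then obtain \<theta> where \<theta>: "\<theta> \<in> A" "(transfer ^^ n) F (\<psi> x \<theta>, u + g \<theta>, v + h \<theta>) \<noteq> 0" by blast
    from Suc.IH[OF \<theta>(2)] obtain ts where "length ts = n" "set ts \<subseteq> A"
      "F (composition \<psi> ts (\<psi> x \<theta>), u + g \<theta> + (\<Sum>\<theta>\<leftarrow>ts. g \<theta>), v + h \<theta> + (\<Sum>\<theta>\<leftarrow>ts. h \<theta>)) \<noteq> 0"
      by blast
    with \<theta>(1) show ?case
      \<comment> \<open>The parameter drawn first is applied first, so it stands last in the
        list.\<close>
      by (intro exI[of _ "ts @ [\<theta>]"]) (simp add: composition_append ac_simps)
  qed auto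
  then show ?thesis using that by blast
qed

end

section \<open>Approximation of support points by fixed points of contractions\<close>

lemma generated_subset_closed_semigroup:
  fixes \<psi> :: "'a::metric_space \<Rightarrow> 't::metric_space \<Rightarrow> 'a"
  assumes "\<And>f. f \<in> generated_semigroup \<psi> \<mu> \<Longrightarrow> continuous_on UNIV f"
  shows "generated_semigroup \<psi> \<mu> \<subseteq> closed_semigroup \<psi> \<mu>"
  unfolding closed_semigroup_def
proof (rule closure_of_subset, rule subsetI)
  fix f assume "f \<in> generated_semigroup \<psi> \<mu>"
  then have f: "continuous_on UNIV f" by (rule assms)
  \<comment> \<open>With the empty compact set the basic open set consists of all continuous
    maps.\<close>
  have "{g. continuous_on UNIV g \<and> (\<forall>x\<in>{}. dist (f x) (g x) < (1::real))} \<in>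
      {{g. continuous_on UNIV g \<and> (\<forall>x\<in>K. dist (h x) (g x) < e)} | h K e.
        continuous_on UNIV (h :: 'a \<Rightarrow> 'a) \<and> compact K \<and> 0 < e}"
    by (rule CollectI, rule exI[of _ f], rule exI[of _ "{}"], rule exI[of _ 1])
      (intro conjI refl f compact_empty zero_less_one)
  moreover have "f \<in> {g. continuous_on UNIV g \<and> (\<forall>x\<in>{}. dist (f x) (g x) < (1::real))}"
    using f by simp
  ultimately show "f \<in> topspace compact_convergence_topology"
    unfolding compact_convergence_topology_def topology_generated_by_topspace by (rule UnionI)
qed

text \<open>The fixed point \<open>p\<close> satisfies
  \<open>dist p (f x) \<le> q * dist p x\<close>. Going from \<open>p\<close> to \<open>x\<close>
  through \<open>f x\<close>, the bound \<open>q \<le> 1/2\<close> absorbs the first leg and the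
  third assumption bounds the rest by \<open>e / 8\<close>, so
  \<open>dist p (f x) \<le> e / 4\<close>.\<close>

lemma contraction_fixed_point_near:
  fixes f :: "'a::complete_space \<Rightarrow> 'a"
  assumes f: "q-lipschitz_on UNIV f" and q: "q \<le> 1/2" and "q * (dist x y + e) \<le> e / 8"
    and fx: "dist (f x) y < e / 2"
  obtains p where "f p = p" "dist p y < e"
proof -
  have q0: "0 \<le> q" using f by (rule lipschitz_on_nonneg)
  have e: "0 < e" using fx zero_le_dist[of "f x" y] by linarith
  have "\<forall>x y. dist (f x) (f y) \<le> q * dist x y" using lipschitz_onD[OF f] by simp
  then have "\<exists>!x. f x = x" using q0 q by (intro banach_fix_type[of q]) simp_all
  then obtain p where p: "f p = p" by (rule ex1E)
  have "dist p (f x) \<le> q * dist p x" using lipschitz_onD[OF f, of p x] p by simp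
  also have "\<dots> \<le> q * (dist p (f x) + (dist x y + e))"
  proof (rule mult_left_mono[OF _ q0])
    show "dist p x \<le> dist p (f x) + (dist x y + e)"
      using dist_triangle[of p x "f x"] dist_triangle2[of "f x" x y] fx e by linarith
  qed
  also have "\<dots> \<le> 1/2 * dist p (f x) + e / 8"
    unfolding distrib_left[of q "dist p (f x)"]
    using assms(3) mult_right_mono[OF q zero_le_dist[of p "f x"]] by linarith
  finally have "dist p (f x) \<le> e / 4" by simp
  then have "dist p y < e" using dist_triangle[of p y "f x"] fx e by linarith
  with p show ?thesis by (rule that)
qed

text \<open>Complements of balls with integer radii decrease to the empty set, so continuity from
  above applies.\<close>

lemma large_ball_complement:
  fixes M :: "'a::metric_space measure"
  assumes "prob_space M" "sets M = sets borel" "0 < a"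
  obtains R where "0 \<le> R" "emeasure M (- cball y R) < ennreal a"
proof -
  interpret prob_space M by fact
  have "(\<lambda>n. measure M (- cball y (real n))) \<longlonglongrightarrow> measure M (\<Inter>n. - cball y (real n))"
    by (rule finite_Lim_measure_decseq) (auto simp: assms(2) decseq_def)
  also have "(\<Inter>n. - cball y (real n)) = {}"
  proof (intro equals0I)
    fix z assume z: "z \<in> (\<Inter>n. - cball y (real n))"
    obtain n :: nat where "dist y z \<le> real n" using real_arch_simple by blast
    with z show False by auto
  qed
  finally have "(\<lambda>n. measure M (- cball y (real n))) \<longlonglongrightarrow> 0" by simp
  then have "eventually (\<lambda>n. measure M (- cball y (real n)) < a) sequentially"
    using \<open>0 < a\<close> by (rule order_tendstoD(2))
  then obtain n where "measure M (- cball y (real n)) < a"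
    by (auto simp: eventually_sequentially)
  then show ?thesis
    by (intro that[of "real n"]) (simp_all add: emeasure_eq_measure ennreal_lessI \<open>0 < a\<close>)
qed

text \<open>The ball of radius \<open>e / 2\<close> around \<open>y\<close> has probability
  \<open>a\<close>. Three bad events (a far starting point, a large sum of \<open>g\<close>, a large
  sum of \<open>h\<close>) cost at most \<open>a / 4\<close> each, which leaves a positive
  probability for the good event.\<close>

lemma support_approximation:
  fixes \<psi> :: "'a::{complete_space,second_countable_topology} \<Rightarrow> 't::metric_space \<Rightarrow> 'a"
  assumes \<mu>: "prob_space \<mu>" "sets \<mu> = sets borel"
    and supp: "AE \<theta> in \<mu>. \<theta> \<in> measure_support \<mu>"
    and \<psi>: "(\<lambda>(x, \<theta>). \<psi> x \<theta>) \<in> borel_measurable (borel \<Otimes>\<^sub>M borel)"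
    and stat: "stationary_measure \<psi> \<mu> \<nu>"
    and lip: "\<And>\<theta>. (exp (l \<theta>))-lipschitz_on UNIV (\<lambda>x. \<psi> x \<theta>)"
    and l: "integrable \<mu> l" "(\<integral>\<theta>. l \<theta> \<partial>\<mu>) < 0"
    and y: "y \<in> measure_support \<nu>" and e: "0 < e"
  shows "\<exists>p\<in>contraction_fixed_points \<psi> \<mu>. dist p y < e"
proof -
  have \<nu>: "prob_space \<nu>" "sets \<nu> = sets borel" using stat by (auto simp: stationary_measure_def)
  interpret \<nu>: prob_space \<nu> by fact
  have [measurable_cong]: "sets \<nu> = sets borel" by fact
  define a where "a = measure \<nu> (ball y (e / 2))"
  have "0 < emeasure \<nu> (ball y (e / 2))" using y e by (auto simp: measure_support_def)
  then have a: "0 < a" by (simp add: a_def \<nu>.emeasure_eq_measure)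
  obtain R where R: "0 \<le> R" "emeasure \<nu> (- cball y R) < ennreal (a / 4)"
    using large_ball_complement[OF \<nu>, of "a / 4" y] a by auto
  obtain g h k B where g: "g \<in> borel_measurable \<mu>" and h: "h \<in> borel_measurable \<mu>"
    and B: "\<And>\<theta>. \<bar>g \<theta>\<bar> \<le> B" and h0: "\<And>\<theta>. 0 \<le> h \<theta>" and le: "\<And>\<theta>. l \<theta> \<le> g \<theta> + h \<theta> - k"
    and k: "0 < k" and gneg: "(\<integral>\<theta>. g \<theta> \<partial>\<mu>) < 0"
    and hint: "(\<integral>\<^sup>+\<theta>. ennreal (h \<theta>) \<partial>\<mu>) \<le> ennreal (a / 4 * k)"
    using negative_mean_majorant[OF \<mu>(1) l, of "a / 4"] a by (metis divide_pos_pos zero_less_numeral)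
  obtain c r where c: "0 < c" and r: "0 \<le> r" "r < 1"
    and mgf: "(\<integral>\<^sup>+\<theta>. ennreal (exp (c * g \<theta>)) \<partial>\<mu>) \<le> ennreal r"
    using exponential_moment_less_1[OF \<mu>(1) g B gneg] by blast
  interpret weighted_iteration \<mu> \<psi> g h
    using \<mu> \<psi> g h by (simp add: weighted_iteration_def weighted_iteration_axioms_def)
  \<comment> \<open>The target Lipschitz constant: both entries of the minimum serve the hypotheses
    of \<open>contraction_fixed_point_near\<close>, for every starting point within \<open>R\<close>
    of \<open>y\<close>.\<close>
  define q where "q = min (1/2) (e / (8 * (R + e)))"
  have q: "0 < q" "q \<le> 1/2" using R e by (auto simp: q_def)
  have qR: "q * (R + e) \<le> e / 8"
  proof -
    have "q * (R + e) \<le> e / (8 * (R + e)) * (R + e)"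
      using R e by (intro mult_right_mono) (auto simp: q_def)
    also have "\<dots> = e / 8" using R e by (simp add: field_simps)
    finally show ?thesis .
  qed
  \<comment> \<open>A sum of \<open>l\<close> below \<open>-t\<close> means a Lipschitz constant of
    at most \<open>q\<close>.\<close>
  define t where "t = - ln q"
  have "(\<lambda>n. exp (c * t) * r ^ n) \<longlonglongrightarrow> exp (c * t) * 0"
    using r by (intro tendsto_mult_left LIMSEQ_realpow_zero) auto
  then have "eventually (\<lambda>n. exp (c * t) * r ^ n < a / 4) sequentially"
    by (rule order_tendstoD(2)) (use a in simp)
  \<comment> \<open>The semigroup has no empty composition, and \<open>K\<close> below must be
    positive, hence \<open>1 \<le> n\<close>.\<close>
  then have "eventually (\<lambda>n. exp (c * t) * r ^ n < a / 4 \<and> 1 \<le> n) sequentially"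
    using eventually_ge_at_top[of "1::nat"] by (rule eventually_conj)
  then obtain n where n: "exp (c * t) * r ^ n < a / 4" "1 \<le> n"
    by (auto simp: eventually_sequentially)
  \<comment> \<open>The sum of \<open>h\<close> has mean at most \<open>a / 4 * K\<close>, so by
    Markov it exceeds \<open>K\<close> with probability at most \<open>a / 4\<close>.\<close>
  define K where "K = real n * k"
  have K: "0 < K" using n k by (simp add: K_def)
  \<comment> \<open>\<open>F\<close> is bounded by the indicator \<open>G\<close> of the good event, a Chernoff bound for the sum of \<open>g\<close> and
    a Markov bound for the sum of \<open>h\<close>.\<close>
  define F where "F = (\<lambda>(x, u::real, v::real). indicator (ball y (e / 2)) x :: ennreal)"
  define G where "G = (\<lambda>(x, u, v). indicator (ball y (e / 2)) x * indicator {..- t} u * indicator {..K} v :: ennreal)"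
  define E where "E = (\<lambda>(x::'a, u, v::real). ennreal (exp (c * u)))"
  define V where "V = (\<lambda>(x::'a, u::real, v). ennreal v)"
  have meas: "G \<in> borel_measurable state_algebra" "E \<in> borel_measurable state_algebra"
      "V \<in> borel_measurable state_algebra"
    unfolding G_def E_def V_def case_prod_beta'
    by (intro borel_measurable_times_ennreal measurable_compose[OF _ measurable_ennreal]
      measurable_compose[OF measurable_fst borel_measurable_indicator]
      measurable_compose[OF measurable_compose[OF measurable_snd measurable_fst] borel_measurable_indicator]
      measurable_compose[OF measurable_compose[OF measurable_snd measurable_snd] borel_measurable_indicator]
      borel_measurable_times measurable_compose[OF _ borel_measurable_exp], auto)
  let ?b = "ennreal (exp (c * t))" and ?d = "ennreal (1 / K)"
  have "F \<le> (\<lambda>s. G s + (?b * E s + ?d * V s))"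
  proof (rule le_funI)
    fix s :: "'a \<times> real \<times> real"
    obtain x u v where s: "s = (x, u, v)" by (cases s)
    consider "u \<le> - t" "v \<le> K" | "- t < u" | "K < v" by linarith
    then show "F s \<le> G s + (?b * E s + ?d * V s)"
    proof cases
      case 1
      then show ?thesis by (simp add: s F_def G_def)
    next
      case 2
      then have "0 \<le> c * t + c * u" using c by (simp flip: distrib_left)
      then have "1 \<le> ?b * E s"
        by (simp add: s E_def ennreal_mult'[symmetric] exp_add[symmetric])
      then have "1 \<le> G s + (?b * E s + ?d * V s)" by (simp add: add_increasing add_increasing2)
      then show ?thesis by (auto simp: s F_def indicator_def)
    next
      case 3
      then have "1 \<le> ?d * V s" using K
        by (simp add: s V_def ennreal_mult'[symmetric] field_simps)
      then have "1 \<le> G s + (?b * E s + ?d * V s)" by (simp add: add_increasing)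
      then show ?thesis by (auto simp: s F_def indicator_def)
    qed
  qed
  then have "(transfer ^^ n) F \<le> (transfer ^^ n) (\<lambda>s. G s + (?b * E s + ?d * V s))"
    by (rule transfer_funpow_mono)
  also have "\<dots> = (\<lambda>s. (transfer ^^ n) G s + (?b * (transfer ^^ n) E s + ?d * (transfer ^^ n) V s))"
    using meas by (simp add: transfer_funpow_add transfer_funpow_cmult)
  finally have T_F: "(transfer ^^ n) F s
      \<le> (transfer ^^ n) G s + (?b * (transfer ^^ n) E s + ?d * (transfer ^^ n) V s)" for s
    by (rule le_funD)
  have "F \<le> (\<lambda>_. 1)" by (rule le_funI) (auto simp: F_def indicator_def)
  then have "(transfer ^^ n) F \<le> (transfer ^^ n) (\<lambda>_. 1)" by (rule transfer_funpow_mono)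
  then have T_F_le_1: "(transfer ^^ n) F s \<le> 1" for s
    unfolding transfer_funpow_const by (rule le_funD)
  \<comment> \<open>Otherwise the term with \<open>G\<close> vanishes on the large ball, where
    \<open>F\<close> then has expectation at most \<open>a / 2\<close>; outside, it is at most 1.
    Integration over \<open>\<nu>\<close> gives less than \<open>3 * a / 4\<close>, whereas
    stationarity gives exactly \<open>a\<close>.\<close>
  have "\<exists>x\<in>cball y R. (transfer ^^ n) G (x, 0, 0) \<noteq> 0"
  proof (rule ccontr)
    assume neg: "\<not> ?thesis"
    have "(transfer ^^ n) F (x, 0, 0) \<le> ennreal (a / 2) + indicator (- cball y R) x" for x
    proof (cases "x \<in> cball y R")
      case True
      have "(transfer ^^ n) E (x, 0, 0) \<le> ennreal (r ^ n)"
        using transfer_funpow_exp[OF mgf r(1), of n x 0 0] by (simp add: E_def)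
      then have "?b * (transfer ^^ n) E (x, 0, 0) \<le> ?b * ennreal (r ^ n)"
        by (rule mult_left_mono) simp
      also have "\<dots> \<le> ennreal (a / 4)"
        using n(1) r(1) by (simp add: ennreal_mult'[symmetric] ennreal_leI)
      finally have 1: "?b * (transfer ^^ n) E (x, 0, 0) \<le> ennreal (a / 4)" .
      have "(transfer ^^ n) V (x, 0, 0) \<le> ennreal (a / 4 * K)"
        using transfer_funpow_snd[OF hint h0, of 0 n x 0] a k by (simp add: V_def K_def ac_simps)
      then have "?d * (transfer ^^ n) V (x, 0, 0) \<le> ?d * ennreal (a / 4 * K)"
        by (rule mult_left_mono) simp
      also have "\<dots> = ennreal (a / 4)" using K a by (simp add: ennreal_mult'[symmetric])
      finally have 2: "?d * (transfer ^^ n) V (x, 0, 0) \<le> ennreal (a / 4)" .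
      have "(transfer ^^ n) F (x, 0, 0) \<le> ennreal (a / 4) + ennreal (a / 4)"
        using T_F[of "(x, 0, 0)"] neg True add_mono[OF 1 2] by (auto intro: order_trans)
      also have "\<dots> = ennreal (a / 2)" using a by (simp flip: ennreal_plus)
      finally show ?thesis using True by simp
    next
      case False
      then show ?thesis using T_F_le_1[of "(x, 0, 0)"] by (simp add: add_increasing)
    qed
    then have "(\<integral>\<^sup>+x. (transfer ^^ n) F (x, 0, 0) \<partial>\<nu>)
        \<le> (\<integral>\<^sup>+x. ennreal (a / 2) + indicator (- cball y R) x \<partial>\<nu>)"
      by (intro nn_integral_mono)
    also have "\<dots> = ennreal (a / 2) + emeasure \<nu> (- cball y R)"
      by (subst nn_integral_add) (auto simp: \<nu>.emeasure_space_1)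
    also have "\<dots> < ennreal (a / 2) + ennreal (a / 4)"
      using R(2) by (simp add: ennreal_add_left_cancel_less)
    also have "\<dots> = ennreal (3 * a / 4)" using a by (simp flip: ennreal_plus)
    finally have "(\<integral>\<^sup>+x. (transfer ^^ n) F (x, 0, 0) \<partial>\<nu>) < ennreal (3 * a / 4)" .
    moreover have "(\<integral>\<^sup>+x. (transfer ^^ n) F (x, 0, 0) \<partial>\<nu>) = ennreal a"
      unfolding F_def using stationary_transfer_funpow[OF stat borel_measurable_indicator[OF borel_open[OF open_ball]],
          of n y "e / 2" 0 0]
      by (simp add: a_def \<nu>.emeasure_eq_measure)
    ultimately show False using a by (simp add: ennreal_less_iff)
  qed
  then obtain x where x: "x \<in> cball y R" "(transfer ^^ n) G (x, 0, 0) \<noteq> 0" by blast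
  from transfer_funpow_witness[OF supp x(2)] obtain ts where
    ts: "length ts = n" "set ts \<subseteq> measure_support \<mu>"
    "G (composition \<psi> ts x, 0 + (\<Sum>\<theta>\<leftarrow>ts. g \<theta>), 0 + (\<Sum>\<theta>\<leftarrow>ts. h \<theta>)) \<noteq> 0"
    by blast
  then have in_ball: "dist (composition \<psi> ts x) y < e / 2"
    and sums: "(\<Sum>\<theta>\<leftarrow>ts. g \<theta>) \<le> - t" "(\<Sum>\<theta>\<leftarrow>ts. h \<theta>) \<le> K"
    by (auto simp: G_def indicator_def dist_commute split: if_splits)
  \<comment> \<open>The subtracted term equals \<open>K\<close> and cancels the bound on the sum of
    \<open>h\<close>, so that \<open>-t\<close> remains.\<close>
  have "(\<Sum>\<theta>\<leftarrow>ts. l \<theta>) \<le> (\<Sum>\<theta>\<leftarrow>ts. g \<theta>) + (\<Sum>\<theta>\<leftarrow>ts. h \<theta>) - real (length ts) * k"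
  proof (induction ts)
    case (Cons \<theta> ts)
    then show ?case using le[of \<theta>] by (simp add: distrib_right)
  qed simp
  then have "(\<Sum>\<theta>\<leftarrow>ts. l \<theta>) \<le> - t" using sums ts(1) by (simp add: K_def)
  then have "exp (\<Sum>\<theta>\<leftarrow>ts. l \<theta>) \<le> q" using q by (metis exp_le_cancel_iff exp_ln minus_minus t_def)
  then have lip_q: "q-lipschitz_on UNIV (composition \<psi> ts)"
    using lipschitz_composition[OF lip, where ts = ts] by (rule lipschitz_on_le[rotated])
  have "q * (dist x y + e) \<le> q * (R + e)"
    using x(1) q by (intro mult_left_mono) (auto simp: dist_commute)
  then have "q * (dist x y + e) \<le> e / 8" using qR by linarith
  then obtain p where p: "composition \<psi> ts p = p" "dist p y < e"
    using contraction_fixed_point_near[OF lip_q q(2) _ in_ball] by blast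
  have "composition \<psi> ts \<in> generated_semigroup \<psi> \<mu>"
    using ts n(2) unfolding generated_semigroup_eq by (intro CollectI exI[of _ ts]) auto
  moreover have "generated_semigroup \<psi> \<mu> \<subseteq> closed_semigroup \<psi> \<mu>"
    by (rule generated_subset_closed_semigroup)
      (auto simp: generated_semigroup_eq intro: lipschitz_on_continuous_on[OF lipschitz_composition[OF lip]])
  ultimately have "p \<in> contraction_fixed_points \<psi> \<mu>"
    using lip_q q p(1) unfolding contraction_fixed_points_def
    by (intro CollectI bexI[of _ "composition \<psi> ts"] conjI exI[of _ q]) auto
  with p(2) show ?thesis by blast
qed

theorem theorem1p8:
  fixes \<psi> :: "real^'d \<Rightarrow> 't::metric_space \<Rightarrow> real^'d"
    and \<mu> :: "'t measure"
    and L :: "'t \<Rightarrow> real"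
    and x0 :: "real^'d"
    and \<nu> :: "(real^'d) measure"
  assumes "prob_space \<mu>" and "sets \<mu> = sets borel"
    and "AE \<theta> in \<mu>. \<theta> \<in> measure_support \<mu>"
    and "(\<lambda>(x, \<theta>). \<psi> x \<theta>) \<in> borel_measurable (borel \<Otimes>\<^sub>M borel)"
    and "\<And>\<theta>. (L \<theta>)-lipschitz_on UNIV (\<lambda>x. \<psi> x \<theta>)"
    and "AE \<theta> in \<mu>. L \<theta> > 0"
    and "integrable \<mu> (\<lambda>\<theta>. ln (L \<theta>))"
    and "(\<integral>\<theta>. ln (L \<theta>) \<partial>\<mu>) < 0"
    and "integrable \<mu> (\<lambda>\<theta>. max 0 (ln (norm (\<psi> x0 \<theta>))))"
    and "\<And>x. continuous_on UNIV (\<lambda>\<theta>. \<psi> x \<theta>)"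
    and "stationary_measure \<psi> \<mu> \<nu>"
  shows "measure_support \<nu> = closure (contraction_fixed_points \<psi> \<mu>)"
proof (rule equalityI)
  \<comment> \<open>Here \<open>ln 0 = 0\<close>, so the bound also holds where \<open>L \<theta> = 0\<close>.\<close>
  have "L \<theta> \<le> exp (ln (L \<theta>))" for \<theta>
    using lipschitz_on_nonneg[OF assms(5), of \<theta>] by (cases "L \<theta> = 0") auto
  then have lip: "(exp (ln (L \<theta>)))-lipschitz_on UNIV (\<lambda>x. \<psi> x \<theta>)" for \<theta>
    using assms(5) by (rule lipschitz_on_le[rotated])
  show "measure_support \<nu> \<subseteq> closure (contraction_fixed_points \<psi> \<mu>)"
    using support_approximation[OF assms(1-4,11) lip assms(7,8)]
    by (auto simp: closure_approachable)
  have "prob_space \<nu>" "sets \<nu> = sets borel"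
    using assms(11) by (auto simp: stationary_measure_def)
  then have "measure_support \<nu> \<noteq> {}" by (rule measure_support_ne)
  \<comment> \<open>Measurability is available for \<open>ln (L \<theta>)\<close>, by integrability,
    but is not assumed for \<open>L\<close>; this is why the constants are taken in the form
    \<open>exp (ln (L \<theta>))\<close>.\<close>
  moreover have "(\<lambda>\<theta>. exp (ln (L \<theta>))) \<in> borel_measurable \<mu>"
    using borel_measurable_integrable[OF assms(7)] by measurable
  ultimately have "contraction_fixed_points \<psi> \<mu> \<subseteq> measure_support \<nu>"
    using stationary_support_invariant[OF assms(1,2,4,11,10) _ lip]
    by (intro contraction_fixed_points_subset closed_measure_support) auto
  then show "closure (contraction_fixed_points \<psi> \<mu>) \<subseteq> measure_support \<nu>"
    by (intro closure_minimal closed_measure_support)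
qed

end
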